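(* Let $\bar f\in\mathbb F_q[x_1^{\pm1},\dots,x_n^{\pm1}]$ and $\mu\in\mathbb Z^n$ satisfy: $\dim\Delta_\infty(\bar f)=n$; $\bar f$ is quasihomogeneous; $\bar f$ is nondegenerate with respect to $\Delta_\infty(\bar f)$; $\mu$ is an interior point of $Cone(\bar f)$ and $l_\sigma(\mu)>1$; $p\nmid\prod_{\tau\in\Gamma}\phi^{(\tau)}(\mu)$. Then for any $\bar\lambda\in\overline{\mathbb F}_q^*$, the Laurent polynomial $\bar F(\bar\lambda,x)=\bar f(x)+\bar\lambda^{-1}x^\mu\in\mathbb F_q(\bar\lambda)[x_1^{\pm1},\dots,x_n^{\pm1}]$ is nondegenerate with respect to $\Delta_\infty(\bar f,\mu)$.
   Context: $q$ is a power of the prime $p$. For a Laurent polynomial $\bar g$, $\Delta_\infty(\bar g)$ is the convex hull of $Supp(\bar g)\cup\{0\}$ and $Cone(\bar g)$ the cone over it; a face "at $\infty$" is a closed face not containing $0$. $\bar g$ is nondegenerate with respect to a polytope $\Delta$ (containing $0$ and $Supp(\bar g)$) if for each face $\tau$ of $\Delta$ at $\infty$, the Laurent polynomials $x_i\partial\bar g^{(\tau)}/\partial x_i$, $1\le i\le n$, where $\bar g^{(\tau)}$ is the sum of the terms of $\bar g$ with exponents in $\tau$, have no common zero in $(\overline{\mathbb F}_q^* )^n$. Quasihomogeneous: $Supp(\bar f)$ lies on an affine hyperplane $l_\sigma(x)=1$ with $l_\sigma$ a rational linear form. $\Gamma$ is the set of codimension-2 faces at $\infty$ of $\Delta_\infty(\bar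 f)$; for $\tau\in\Gamma$, $\phi^{(\tau)}$ is the integral linear form with relatively prime coefficients vanishing on $\tau\cup\{0\}$, signs chosen so that $Cone(\bar f)=\{\phi^{(\tau)}\ge0\ \forall\tau\in\Gamma\}$. $\Delta_\infty(\bar f,\mu)$ is the convex hull of $\Delta_\infty(\bar f)\cup\{\mu\}$. *)

theory Defs
  imports
    "HOL-Algebra.Algebraic_Closure_Type"
    "HOL-Library.Poly_Mapping"
    "HOL-Analysis.Analysis"
begin

text \<open>
  Laurent polynomials in the variables \<open>x\<^sub>i\<close>, \<open>i :: 'n\<close>, over \<open>'k\<close> are elements of the
  group algebra \<open>(int ^ 'n) \<Rightarrow>\<^sub>0 'k\<close>, with \<open>Poly_Mapping.single u c\<close> standing for \<open>c x\<^sup>u\<close>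
  and \<open>Poly_Mapping.keys\<close> for the support.
\<close>

type_synonym ('n, 'k) laurent = "(int ^ 'n) \<Rightarrow>\<^sub>0 'k"

definition of_int_vec :: "int ^ 'n \<Rightarrow> 'b::ring_1 ^ 'n" where
  "of_int_vec u = (\<chi> i. of_int (u $ i))"

definition laurent_eval :: "('n::finite, 'k::field) laurent \<Rightarrow> 'k ^ 'n \<Rightarrow> 'k" where
  "laurent_eval g x =
     (\<Sum>u\<in>Poly_Mapping.keys g. Poly_Mapping.lookup g u * (\<Prod>i\<in>UNIV. (x $ i) powi (u $ i)))"

definition laurent_var :: "'n::finite \<Rightarrow> ('n, 'k::field) laurent" where
  "laurent_var i = Poly_Mapping.single (axis i 1) 1"

definition laurent_deriv :: "'n::finite \<Rightarrow> ('n, 'k::field) laurent \<Rightarrow> ('n, 'k) laurent" where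
  "laurent_deriv i g =
     (\<Sum>u\<in>Poly_Mapping.keys g.
        Poly_Mapping.single (u - axis i 1) (of_int (u $ i) * Poly_Mapping.lookup g u))"

definition laurent_restrict :: "(real ^ 'n) set \<Rightarrow> ('n::finite, 'k::field) laurent \<Rightarrow> ('n, 'k) laurent" where
  "laurent_restrict \<tau> g =
     (\<Sum>u | u \<in> Poly_Mapping.keys g \<and> of_int_vec u \<in> \<tau>.
        Poly_Mapping.single u (Poly_Mapping.lookup g u))"

definition newton_polytope :: "('n::finite, 'k::field) laurent \<Rightarrow> (real ^ 'n) set" where
  "newton_polytope g = convex hull (of_int_vec ` Poly_Mapping.keys g \<union> {0})"

definition newton_polytope_with :: "('n::finite, 'k::field) laurent \<Rightarrow> int ^ 'n \<Rightarrow> (real ^ 'n) set" where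
  "newton_polytope_with g \<mu> = convex hull (newton_polytope g \<union> {of_int_vec \<mu>})"

definition newton_cone :: "('n::finite, 'k::field) laurent \<Rightarrow> (real ^ 'n) set" where
  "newton_cone g = cone hull (newton_polytope g)"

text \<open>
  The empty set is a \<open>face_of\<close> every set. It is a face at infinity here, of dimension -1; the
  notion of nondegeneracy has to skip it, since the restriction of \<open>g\<close> to it is zero.
\<close>

definition face_at_infinity :: "(real ^ 'n::finite) set \<Rightarrow> (real ^ 'n) set \<Rightarrow> bool" where
  "face_at_infinity \<tau> \<Delta> \<longleftrightarrow> \<tau> face_of \<Delta> \<and> 0 \<notin> \<tau>"

definition nondegenerate :: "('n::finite, 'k::alg_closed_field) laurent \<Rightarrow> (real ^ 'n) set \<Rightarrow> bool" where
  "nondegenerate g \<Delta> \<longleftrightarrow>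
     (\<forall>\<tau>. face_at_infinity \<tau> \<Delta> \<and> \<tau> \<noteq> {} \<longrightarrow>
        \<not> (\<exists>x :: 'k ^ 'n. (\<forall>i. x $ i \<noteq> 0) \<and>
             (\<forall>i. laurent_eval (laurent_var i * laurent_deriv i (laurent_restrict \<tau> g)) x = 0)))"

definition quasihomogeneous :: "rat ^ 'n \<Rightarrow> ('n::finite, 'k::field) laurent \<Rightarrow> bool" where
  "quasihomogeneous l g \<longleftrightarrow>
     (\<forall>u\<in>Poly_Mapping.keys g. scalar_product l (of_int_vec u) = 1)"

text \<open>
  For \<open>CARD('n) = 1\<close> the only element of this set is the empty face; it yields the form
  \<open>x\<close> or \<open>-x\<close> that cuts out the half-line \<open>newton_cone g\<close>.
\<close>

definition codim2_faces :: "('n::finite, 'k::field) laurent \<Rightarrow> (real ^ 'n) set set" where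
  "codim2_faces g =
     {\<tau>. face_at_infinity \<tau> (newton_polytope g) \<and> aff_dim \<tau> = int CARD('n) - 2}"

text \<open>
  The family of primitive integral linear forms (given by their coefficient vectors) that
  define the cone; on \<open>codim2_faces g\<close> it is unique if the polytope has full dimension and
  \<open>g\<close> is quasihomogeneous. Its values elsewhere are irrelevant.
\<close>

definition is_facet_forms ::
    "('n::finite, 'k::field) laurent \<Rightarrow> ((real ^ 'n) set \<Rightarrow> int ^ 'n) \<Rightarrow> bool" where
  "is_facet_forms g \<phi> \<longleftrightarrow>
     (\<forall>\<tau>\<in>codim2_faces g.
        Gcd (range (\<lambda>i. \<phi> \<tau> $ i)) = 1 \<and>
        (\<forall>x\<in>\<tau> \<union> {0}. scalar_product (of_int_vec (\<phi> \<tau>)) x = 0)) \<and>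
     newton_cone g = {x. \<forall>\<tau>\<in>codim2_faces g. scalar_product (of_int_vec (\<phi> \<tau>)) x \<ge> 0}"

definition laurent_to_ac :: "('n::finite, 'a::field) laurent \<Rightarrow> ('n, 'a alg_closure) laurent" where
  "laurent_to_ac g = Poly_Mapping.map to_ac g"

end

theory Submission
  imports Defs "HOL-Number_Theory.Residues"
begin

text \<open>
  A face at infinity of the enlarged polytope that misses \<open>\<mu>\<close> is a face of the original polytope
  on which both polynomials agree. If it contains \<open>\<mu>\<close>, subtract its normalized supporting form
  from \<open>l\<^sub>\<sigma>\<close>: the difference is nonnegative on the cone, positive at \<open>\<mu>\<close>, and zero on the exponents
  of \<open>f\<close> in the face. Their sum is therefore not interior to the cone, so some \<open>\<phi> \<tau>\<close> vanishes on
  all of them. Contracting the logarithmic gradient with \<open>\<phi> \<tau>\<close> kills every term but the monomial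
  \<open>x\<^sup>\<mu>\<close>, which survives because \<open>p\<close> does not divide \<open>\<phi> \<tau> (\<mu>)\<close>.
\<close>

section \<open>Coefficients and evaluation of Laurent polynomials\<close>

lemma laurent_eval_eq_sum:
  assumes "finite S" "Poly_Mapping.keys g \<subseteq> S"
  shows "laurent_eval g x = (\<Sum>u\<in>S. Poly_Mapping.lookup g u * (\<Prod>i\<in>UNIV. (x $ i) powi (u $ i)))"
  unfolding laurent_eval_def
  by (rule sum.mono_neutral_left) (use assms in \<open>auto simp: in_keys_iff\<close>)

lemma lookup_laurent_restrict:
  "Poly_Mapping.lookup (laurent_restrict \<tau> g) u =
     (if of_int_vec u \<in> \<tau> then Poly_Mapping.lookup g u else 0)"
  by (auto simp: laurent_restrict_def lookup_sum lookup_single when_def in_keys_iff)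

text \<open>Multiplying by \<open>laurent_var i\<close> undoes the exponent shift of the derivative,
  so the operator acts diagonally on monomials.\<close>

lemma lookup_log_deriv:
  "Poly_Mapping.lookup (laurent_var i * laurent_deriv i g) u = of_int (u $ i) * Poly_Mapping.lookup g u"
proof -
  have "laurent_var i * laurent_deriv i g =
      (\<Sum>v\<in>Poly_Mapping.keys g. Poly_Mapping.single v (of_int (v $ i) * Poly_Mapping.lookup g v))"
    by (simp add: laurent_var_def laurent_deriv_def sum_distrib_left mult_single)
  then show ?thesis
    by (auto simp: lookup_sum lookup_single when_def in_keys_iff)
qed

lemma laurent_eval_log_deriv_restrict:
  "laurent_eval (laurent_var i * laurent_deriv i (laurent_restrict \<tau> g)) x =
     (\<Sum>u | u \<in> Poly_Mapping.keys g \<and> of_int_vec u \<in> \<tau>.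
        of_int (u $ i) * Poly_Mapping.lookup g u * (\<Prod>j\<in>UNIV. (x $ j) powi (u $ j)))"
proof -
  have "laurent_eval (laurent_var i * laurent_deriv i (laurent_restrict \<tau> g)) x =
      (\<Sum>u | u \<in> Poly_Mapping.keys g \<and> of_int_vec u \<in> \<tau>.
        Poly_Mapping.lookup (laurent_var i * laurent_deriv i (laurent_restrict \<tau> g)) u *
        (\<Prod>j\<in>UNIV. (x $ j) powi (u $ j)))"
    \<comment> \<open>The support may shrink, since \<open>of_int (u $ i)\<close> can vanish in
      positive characteristic; the sum is therefore taken over a superset of it.\<close>
    by (rule laurent_eval_eq_sum)
       (auto simp: in_keys_iff lookup_log_deriv lookup_laurent_restrict split: if_splits)
  then show ?thesis
    by (simp add: lookup_log_deriv lookup_laurent_restrict)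
qed

lemma lookup_laurent_to_ac: "Poly_Mapping.lookup (laurent_to_ac g) u = to_ac (Poly_Mapping.lookup g u)"
  by (simp add: laurent_to_ac_def Poly_Mapping.map.rep_eq when_def)

text \<open>The characteristic of a finite field is a prime dividing its cardinality, and the
  algebraic closure has the same characteristic.\<close>

lemma of_int_alg_closure_eq_0_iff:
  assumes "Factorial_Ring.prime p" and "CARD('a::{field,finite}) = p ^ r"
  shows "of_int k = (0 :: 'a alg_closure) \<longleftrightarrow> int p dvd k"
proof -
  have "CHAR('a) > 0"
    by (rule finite_imp_CHAR_pos) simp
  then have "Factorial_Ring.prime CHAR('a)"
    by (rule prime_CHAR_semidom)
  moreover have "CHAR('a) dvd p ^ r"
    using CHAR_dvd_CARD[where 'a='a] assms(2) by simp
  ultimately have "CHAR('a) = p"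
    using assms(1) by (metis prime_dvd_power primes_dvd_imp_eq)
  then show ?thesis
    by (simp add: of_int_eq_0_iff_char_dvd)
qed

section \<open>Linear forms, Newton polytopes and their cones\<close>

lemma scalar_product_real: "scalar_product v w = v \<bullet> (w :: real ^ 'n)"
  by (simp add: scalar_product_def inner_vec_def)

lemma inner_of_int_vec: "of_int_vec u \<bullet> (of_int_vec v :: real ^ 'n) = of_int (scalar_product u v)"
  by (simp add: scalar_product_def inner_vec_def of_int_vec_def)

lemma inner_of_rat_vec:
  "(\<chi> i. of_rat (l $ i)) \<bullet> (of_int_vec u :: real ^ 'n) = of_rat (scalar_product l (of_int_vec u))"
  by (simp add: scalar_product_def inner_vec_def of_int_vec_def of_rat_sum of_rat_mult)

text \<open>The half-space is convex, contains 0 and is stable under nonnegative scaling, so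
  checking the exponents suffices.\<close>

lemma newton_cone_subset_halfspace:
  assumes "\<And>u. u \<in> Poly_Mapping.keys g \<Longrightarrow> w \<bullet> of_int_vec u \<ge> 0" and "x \<in> newton_cone g"
  shows "w \<bullet> x \<ge> 0"
proof -
  have "newton_polytope g \<subseteq> {x. w \<bullet> x \<ge> 0}"
    unfolding newton_polytope_def
    by (rule hull_minimal) (use assms(1) in \<open>auto intro: convex_halfspace_ge\<close>)
  then show ?thesis
    using assms(2) by (auto simp: newton_cone_def cone_hull_expl)
qed

lemma newton_polytope_with_eq:
  "newton_polytope_with g \<mu> = convex hull (insert (of_int_vec \<mu>) (of_int_vec ` Poly_Mapping.keys g \<union> {0}))"
  unfolding newton_polytope_with_def newton_polytope_def hull_Un_left[symmetric] by simp

lemma polytope_newton_polytope: "polytope (newton_polytope g)"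
  by (auto simp: newton_polytope_def intro: polytope_convex_hull)

lemma polytope_newton_polytope_with: "polytope (newton_polytope_with g \<mu>)"
  by (auto simp: newton_polytope_with_eq intro: polytope_convex_hull)

text \<open>A face of the hull of a finite set is the hull of some of the generators. If it misses
  \<mu>, then \<mu> is not among them, so the face already lies in the smaller polytope.\<close>

lemma face_of_newton_polytope_with_avoiding:
  fixes g :: "('n::finite, 'k::field) laurent"
  assumes "\<tau> face_of newton_polytope_with g \<mu>" and "of_int_vec \<mu> \<notin> \<tau>"
  shows "\<tau> face_of newton_polytope g"
proof -
  let ?S = "insert (of_int_vec \<mu>) (of_int_vec ` Poly_Mapping.keys g \<union> {0}) :: (real ^ 'n) set"
  have "compact ?S"
    by (rule finite_imp_compact) simp
  moreover have "\<tau> face_of convex hull ?S"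
    using assms(1) by (simp only: newton_polytope_with_eq)
  ultimately obtain S' where S': "S' \<subseteq> ?S" "\<tau> = convex hull S'"
    by (rule face_of_convex_hull_subset)
  have "of_int_vec \<mu> \<notin> S'"
    using assms(2) hull_inc[of "of_int_vec \<mu>" S' convex] by (auto simp only: S'(2))
  with S'(1) have "S' \<subseteq> of_int_vec ` Poly_Mapping.keys g \<union> {0}"
    by blast
  then have "\<tau> \<subseteq> newton_polytope g"
    unfolding S'(2) newton_polytope_def by (rule hull_mono)
  moreover have "newton_polytope g \<subseteq> newton_polytope_with g \<mu>"
    unfolding newton_polytope_with_def by (rule order_trans[OF Un_upper1 hull_subset])
  ultimately show ?thesis
    by (rule face_of_subset[OF assms(1)])
qed

section \<open>Facet forms of the cone\<close>

lemma finite_codim2_faces: "finite (codim2_faces g)"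
proof (rule finite_subset)
  show "codim2_faces g \<subseteq> {F. F face_of newton_polytope g}"
    by (auto simp: codim2_faces_def face_at_infinity_def)
  show "finite {F. F face_of newton_polytope g}"
    by (rule finite_polytope_faces) (rule polytope_newton_polytope)
qed

text \<open>If every form were positive at the sum of \<open>A\<close>, that point could be moved
  slightly in direction \<open>-y\<close> within the cone, making \<open>w\<close> negative. So some
  form is nonpositive at the sum; being nonnegative on each summand, it vanishes on all of
  \<open>A\<close>. For empty \<open>A\<close> the argument still yields a face.\<close>

lemma facet_form_vanishing:
  assumes \<phi>: "newton_cone g = {x. \<forall>\<tau>\<in>codim2_faces g. scalar_product (of_int_vec (\<phi> \<tau>)) x \<ge> 0}"
    and nonneg: "\<And>x. x \<in> newton_cone g \<Longrightarrow> w \<bullet> x \<ge> 0"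
    and pos: "w \<bullet> y > 0"
    and A: "finite A" "A \<subseteq> newton_cone g" "\<And>a. a \<in> A \<Longrightarrow> w \<bullet> a = 0"
  obtains \<tau> where "\<tau> \<in> codim2_faces g" "\<And>a. a \<in> A \<Longrightarrow> of_int_vec (\<phi> \<tau>) \<bullet> a = 0"
proof -
  let ?U = "\<Inter>\<tau>\<in>codim2_faces g. {x. 0 < of_int_vec (\<phi> \<tau>) \<bullet> x}"
  let ?s = "\<Sum>a\<in>A. a"
  have nn: "of_int_vec (\<phi> \<tau>) \<bullet> a \<ge> 0" if "\<tau> \<in> codim2_faces g" "a \<in> A" for \<tau> a
    using A(2) that unfolding \<phi> by (auto simp: scalar_product_real)
  have "?s \<notin> ?U"
  proof
    assume "?s \<in> ?U"
    \<comment> \<open>Finiteness of the set of faces makes this intersection of open half-spaces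
      open.\<close>
    moreover have "open ?U"
      by (intro open_INT finite_codim2_faces ballI open_halfspace_gt)
    moreover have "((\<lambda>t. ?s - t *\<^sub>R y) \<longlongrightarrow> ?s - 0 *\<^sub>R y) (at_right 0)"
      by (intro tendsto_intros)
    ultimately have "\<forall>\<^sub>F t in at_right (0::real). ?s - t *\<^sub>R y \<in> ?U"
      by (intro topological_tendstoD[where S = ?U]) auto
    moreover have "\<forall>\<^sub>F t in at_right (0::real). t > 0"
      by (simp add: eventually_at_right_less)
    ultimately have "\<forall>\<^sub>F t in at_right (0::real). t > 0 \<and> ?s - t *\<^sub>R y \<in> ?U"
      by eventually_elim simp
    then obtain t :: real where t: "t > 0" "?s - t *\<^sub>R y \<in> ?U"
      using eventually_happens'[OF trivial_limit_at_right_real] by blast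
    have "?s - t *\<^sub>R y \<in> newton_cone g"
      unfolding \<phi> using t(2) by (auto simp: scalar_product_real intro: less_imp_le)
    then have "0 \<le> w \<bullet> (?s - t *\<^sub>R y)"
      by (rule nonneg)
    also have "\<dots> = - t * (w \<bullet> y)"
      using A(3) by (simp add: inner_diff_right inner_sum_right)
    also have "\<dots> < 0"
      using t(1) pos by simp
    finally show False by simp
  qed
  then obtain \<tau> where \<tau>: "\<tau> \<in> codim2_faces g" "of_int_vec (\<phi> \<tau>) \<bullet> ?s \<le> 0"
    by (auto simp: not_less)
  from \<tau>(2) nn[OF \<tau>(1)] have "(\<Sum>a\<in>A. of_int_vec (\<phi> \<tau>) \<bullet> a) = 0"
    by (simp add: inner_sum_right antisym sum_nonneg)
  then have "of_int_vec (\<phi> \<tau>) \<bullet> a = 0" if "a \<in> A" for a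
    using that nn[OF \<tau>(1)] A(1) by (simp add: sum_nonneg_eq_0_iff)
  with \<tau>(1) show ?thesis by (rule that)
qed

lemma facet_form_vanishing_on_face:
  fixes g :: "('n::finite, 'k::field) laurent"
  assumes \<phi>: "is_facet_forms g \<phi>"
    and l: "quasihomogeneous l g" "scalar_product l (of_int_vec \<mu>) > 1"
    and \<tau>: "face_at_infinity \<tau> (newton_polytope_with g \<mu>)" "of_int_vec \<mu> \<in> \<tau>"
  obtains \<sigma> where "\<sigma> \<in> codim2_faces g"
    "\<And>u. u \<in> Poly_Mapping.keys g \<Longrightarrow> of_int_vec u \<in> \<tau> \<Longrightarrow> scalar_product (\<phi> \<sigma>) u = 0"
proof -
  let ?\<Delta> = "newton_polytope_with g \<mu>"
  \<comment> \<open>The rational form is transported to the real space that contains the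
    polytopes.\<close>
  let ?L = "(\<chi> i. of_rat (l $ i)) :: real ^ 'n"
  have "\<tau> exposed_face_of ?\<Delta>"
    using \<tau>(1) exposed_face_of_polyhedron polytope_imp_polyhedron polytope_newton_polytope_with
    unfolding face_at_infinity_def by blast
  then obtain h b where h: "?\<Delta> \<subseteq> {x. h \<bullet> x \<le> b}" "\<tau> = ?\<Delta> \<inter> {x. h \<bullet> x = b}"
    by (auto simp: exposed_face_of_def)
  have verts: "insert (of_int_vec \<mu>) (of_int_vec ` Poly_Mapping.keys g \<union> {0}) \<subseteq> ?\<Delta>"
    unfolding newton_polytope_with_eq by (rule hull_subset)
  then have "0 \<in> ?\<Delta>" by blast
  \<comment> \<open>The bound at 0 gives \<open>b \<ge> 0\<close>, and \<open>b = 0\<close> would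
    put 0 into the face.\<close>
  with h \<tau>(1) have b: "b > 0"
    by (force simp: face_at_infinity_def)
  \<comment> \<open>Dividing by \<open>b\<close> makes the supporting form equal to 1 on the face
    and at most 1 on the polytope, which matches the value 1 of \<open>?L\<close> on the
    exponents.\<close>
  define w where "w = ?L - (1 / b) *\<^sub>R h"
  have w: "w \<bullet> x = ?L \<bullet> x - (h \<bullet> x) / b" for x
    by (simp add: w_def inner_diff_left)
  have L: "?L \<bullet> of_int_vec u = 1" if "u \<in> Poly_Mapping.keys g" for u
    using l(1) that by (simp add: inner_of_rat_vec quasihomogeneous_def)
  let ?A = "of_int_vec ` {u \<in> Poly_Mapping.keys g. of_int_vec u \<in> \<tau>} :: (real ^ 'n) set"
  have nonneg: "w \<bullet> x \<ge> 0" if "x \<in> newton_cone g" for x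
  proof (rule newton_cone_subset_halfspace[OF _ that])
    fix u assume u: "u \<in> Poly_Mapping.keys g"
    then have "h \<bullet> of_int_vec u \<le> b" using verts h(1) by blast
    then show "w \<bullet> of_int_vec u \<ge> 0" using b L[OF u] by (simp add: w)
  qed
  have pos: "w \<bullet> of_int_vec \<mu> > 0"
  proof -
    have "(of_rat 1 :: real) < of_rat (scalar_product l (of_int_vec \<mu>))"
      using l(2) by (simp only: of_rat_less)
    moreover have "h \<bullet> of_int_vec \<mu> = b" using \<tau>(2) h(2) by simp
    ultimately show ?thesis using b by (simp add: w inner_of_rat_vec)
  qed
  have cone: "newton_cone g = {x. \<forall>\<tau>\<in>codim2_faces g. scalar_product (of_int_vec (\<phi> \<tau>)) x \<ge> 0}"
    using \<phi> by (simp add: is_facet_forms_def)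
  have fin: "finite ?A" by simp
  have sub: "?A \<subseteq> newton_cone g"
    unfolding newton_cone_def newton_polytope_def by (blast intro: hull_inc)
  have zero: "w \<bullet> a = 0" if "a \<in> ?A" for a
    using that h(2) b L by (auto simp: w)
  obtain \<sigma> where \<sigma>: "\<sigma> \<in> codim2_faces g"
    "\<And>a. a \<in> ?A \<Longrightarrow> of_int_vec (\<phi> \<sigma>) \<bullet> a = 0"
    using facet_form_vanishing[OF cone nonneg pos fin sub zero] by blast
  show ?thesis
  proof (rule that[OF \<sigma>(1)])
    fix u assume "u \<in> Poly_Mapping.keys g" "of_int_vec u \<in> \<tau>"
    then have "of_int_vec (\<phi> \<sigma>) \<bullet> (of_int_vec u :: real ^ 'n) = 0" using \<sigma>(2) by blast
    then show "scalar_product (\<phi> \<sigma>) u = 0" by (simp add: inner_of_int_vec)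
  qed
qed

section \<open>Contraction of the logarithmic gradient and exclusion of common zeros\<close>

lemma sum_form_log_deriv:
  "(\<Sum>i\<in>UNIV. of_int (c $ i) * laurent_eval (laurent_var i * laurent_deriv i (laurent_restrict \<tau> g)) x) =
     (\<Sum>u | u \<in> Poly_Mapping.keys g \<and> of_int_vec u \<in> \<tau>.
        of_int (scalar_product c u) * Poly_Mapping.lookup g u * (\<Prod>j\<in>UNIV. (x $ j) powi (u $ j)))"
  \<comment> \<open>Exchanging the sums collects the factors \<open>u $ i\<close> into the value of
    the form \<open>c\<close> at \<open>u\<close>, so exponents in the kernel of \<open>c\<close>
    drop out.\<close>
  unfolding laurent_eval_log_deriv_restrict sum_distrib_left
  by (subst sum.swap) (simp add: scalar_product_def sum_distrib_right mult.assoc)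

theorem theorem5p1:
  fixes p q r :: nat
    and f :: "('n::finite, 'a::{field,finite}) laurent"
    and \<mu> :: "int ^ 'n"
    and l\<^sub>\<sigma> :: "rat ^ 'n"
    and \<phi> :: "(real ^ 'n) set \<Rightarrow> int ^ 'n"
    and lam :: "'a alg_closure"
  assumes "Factorial_Ring.prime p" and "r \<ge> 1" and "q = p ^ r" and "CARD('a) = q"
    and "aff_dim (newton_polytope f) = int CARD('n)"
    and "quasihomogeneous l\<^sub>\<sigma> f"
    and "nondegenerate (laurent_to_ac f) (newton_polytope f)"
    and "of_int_vec \<mu> \<in> interior (newton_cone f)"
    and "scalar_product l\<^sub>\<sigma> (of_int_vec \<mu>) > 1"
    and "is_facet_forms f \<phi>"
    and "\<not> int p dvd (\<Prod>\<tau>\<in>codim2_faces f. scalar_product (\<phi> \<tau>) \<mu>)"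
    and "lam \<noteq> 0"
  shows "nondegenerate (laurent_to_ac f + Poly_Mapping.single \<mu> (inverse lam))
           (newton_polytope_with f \<mu>)"
  unfolding nondegenerate_def
proof (intro allI impI notI, elim conjE exE)
  let ?F = "laurent_to_ac f + Poly_Mapping.single \<mu> (inverse lam)"
  fix \<tau> and x :: "'a alg_closure ^ 'n"
  assume \<tau>: "face_at_infinity \<tau> (newton_polytope_with f \<mu>)" "\<tau> \<noteq> {}"
    and x: "\<forall>i. x $ i \<noteq> 0"
    and zero: "\<forall>i. laurent_eval (laurent_var i * laurent_deriv i (laurent_restrict \<tau> ?F)) x = 0"
  show False
  proof (cases "of_int_vec \<mu> \<in> \<tau>")
    case False
    have "laurent_restrict \<tau> ?F = laurent_restrict \<tau> (laurent_to_ac f)"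
      by (rule poly_mapping_eqI)
         (use False in \<open>auto simp: lookup_laurent_restrict lookup_add lookup_single when_def\<close>)
    moreover have "face_at_infinity \<tau> (newton_polytope f)"
      using \<tau>(1) False face_of_newton_polytope_with_avoiding by (auto simp: face_at_infinity_def)
    ultimately show False
      using assms(7) \<tau>(2) x zero unfolding nondegenerate_def by metis
  next
    case True
    obtain \<sigma> where \<sigma>: "\<sigma> \<in> codim2_faces f"
      "\<And>u. u \<in> Poly_Mapping.keys f \<Longrightarrow> of_int_vec u \<in> \<tau> \<Longrightarrow> scalar_product (\<phi> \<sigma>) u = 0"
      using facet_form_vanishing_on_face[OF assms(10,6,9) \<tau>(1) True] by blast
    let ?T = "{u. u \<in> Poly_Mapping.keys ?F \<and> of_int_vec u \<in> \<tau>}"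
    let ?m = "\<lambda>u. Poly_Mapping.lookup ?F u * (\<Prod>j\<in>UNIV. (x $ j) powi (u $ j))"
    \<comment> \<open>The form is 1 on the support but exceeds 1 at \<mu>; hence the new term cannot
      cancel against a term of \<open>f\<close>.\<close>
    have \<mu>_notin: "\<mu> \<notin> Poly_Mapping.keys f"
      using assms(6,9) by (auto simp: quasihomogeneous_def)
    then have F\<mu>: "Poly_Mapping.lookup ?F \<mu> = inverse lam"
      by (simp add: lookup_add lookup_laurent_to_ac in_keys_iff)
    have \<mu>_in: "\<mu> \<in> ?T"
      using True assms(12) F\<mu> by (simp add: in_keys_iff)
    have keys: "u \<in> Poly_Mapping.keys f" if "u \<in> ?T" "u \<noteq> \<mu>" for u
      using that by (auto simp: in_keys_iff lookup_add lookup_single when_def lookup_laurent_to_ac)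
    have "0 = (\<Sum>u\<in>?T. of_int (scalar_product (\<phi> \<sigma>) u) * ?m u)"
      using sum_form_log_deriv[of "\<phi> \<sigma>" \<tau> ?F x] zero by (simp add: mult.assoc)
    also have "\<dots> = (\<Sum>u\<in>{\<mu>}. of_int (scalar_product (\<phi> \<sigma>) u) * ?m u)"
      using \<mu>_in keys \<sigma>(2) by (intro sum.mono_neutral_right) auto
    also have "\<dots> = of_int (scalar_product (\<phi> \<sigma>) \<mu>) * inverse lam * (\<Prod>j\<in>UNIV. (x $ j) powi (\<mu> $ j))"
      using F\<mu> by simp
    \<comment> \<open>The other factors, \<open>inverse lam\<close> and the monomial at a point of
      the torus, are nonzero.\<close>
    finally have "of_int (scalar_product (\<phi> \<sigma>) \<mu>) = (0 :: 'a alg_closure)"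
      using assms(12) x by simp
    then have "int p dvd scalar_product (\<phi> \<sigma>) \<mu>"
      using of_int_alg_closure_eq_0_iff[OF assms(1)] assms(3,4) by blast
    also have "\<dots> dvd (\<Prod>\<tau>\<in>codim2_faces f. scalar_product (\<phi> \<tau>) \<mu>)"
      using finite_codim2_faces \<sigma>(1) by (rule dvd_prodI)
    finally show False
      using assms(11) by blast
  qed
qed

end
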